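(* Let $n\ge 1$ be an integer and $0<\alpha<2$. Let $u\in E=C^{1,1}_{loc}(\mathbb{R}^n)\cap L_\alpha$ be a real-valued solution of the fractional Ginzburg-Landau equation $$(-\Delta)^{\alpha/2}u=u(1-|u|^2)\quad\text{in } \mathbb{R}^n$$ such that $$\int_{\mathbb{R}^n}(1-|u|^2)^2\,dx<\infty .$$ Then $|u(x)|\le 1$ for all $x\in\mathbb{R}^n$.
   Context: For $0<\alpha<2$, $$L_\alpha=\Big\{u\in L^1_{loc}(\mathbb{R}^n):\ \int_{\mathbb{R}^n}\frac{|u(x)|}{1+|x|^{n+\alpha}}\,dx<\infty\Big\},\qquad E=C^{1,1}_{loc}(\mathbb{R}^n)\cap L_\alpha .$$ Here $C^{1,1}_{loc}(\mathbb{R}^n)$ is the set of $C^1$ functions whose first derivatives are locally Lipschitz. For $u\in E$ the fractional Laplacian is defined pointwise by $$(-\Delta)^{\alpha/2}u(x)=C_{n,\alpha}\,\mathrm{P.V.}\int_{\mathbb{R}^n}\frac{u(x)-u(y)}{|x-y|^{n+\alpha}}\,dy=C_{n,\alpha}\lim_{\varepsilon\to0^+}\int_{|x-y|>\varepsilon}\frac{u(x)-u(y)}{|x-y|^{n+\alpha}}\,dy,$$ where $C_{n,\alpha}>0$ is the usual normalization constant $C_{n,\alpha}=\dfrac{2^\alpha\,\Gamma((n+\alpha)/2)}{\pi^{n/2}\,|\Gamma(-\alpha/2)|}$ (so that $(-\Delta)^{\alpha/2}$ has Fourier symbol $|\xi|^\alpha$). The equation is understood to hold at every point $x\in\mathbb{R}^n$.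 *)

theory Defs
  imports "HOL-Analysis.Analysis"
begin

definition L1_loc :: "('a::euclidean_space \<Rightarrow> real) set" where
  "L1_loc = {u. \<forall>K. compact K \<longrightarrow> set_integrable lebesgue K u}"

definition L_weighted :: "real \<Rightarrow> ('a::euclidean_space \<Rightarrow> real) set" where
  "L_weighted \<alpha> = {u \<in> L1_loc.
     integrable lebesgue (\<lambda>x. \<bar>u x\<bar> / (1 + norm x powr (real DIM('a) + \<alpha>)))}"

text \<open>Here \<open>Du\<close> is the gradient; it is locally Lipschitz iff all first partial derivatives are.\<close>

definition C11_loc :: "('a::euclidean_space \<Rightarrow> real) set" where
  "C11_loc = {u. \<exists>Du. (\<forall>x. GDERIV u x :> Du x) \<and> continuous_on UNIV Du \<and>
     (\<forall>x. \<exists>r>0. \<exists>L. L-lipschitz_on (ball x r) Du)}"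

definition frac_const :: "nat \<Rightarrow> real \<Rightarrow> real" where
  "frac_const n \<alpha> = 2 powr \<alpha> * Gamma ((real n + \<alpha>) / 2) /
     (pi powr (real n / 2) * \<bar>Gamma (- \<alpha> / 2)\<bar>)"

text \<open>
  The principal value is meaningful for \<open>u \<in> C11_loc \<inter> L_weighted \<alpha>\<close> with \<open>0 < \<alpha> < 2\<close>:
  then the truncated integrals converge absolutely and their limit exists at every point.
  Otherwise \<open>Lim\<close> may return an arbitrary value.
\<close>

definition frac_laplacian :: "real \<Rightarrow> ('a::euclidean_space \<Rightarrow> real) \<Rightarrow> 'a \<Rightarrow> real" where
  "frac_laplacian \<alpha> u x = frac_const DIM('a) \<alpha> *
     Lim (at_right 0) (\<lambda>\<epsilon>. LINT y:{y. norm (x - y) > \<epsilon>}|lebesgue.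
       (u x - u y) / norm (x - y) powr (real DIM('a) + \<alpha>))"

end

theory Submission
  imports Defs
begin

text \<open>
  Suppose \<open>w = u - 1\<close> is positive at \<open>z\<close>. For large \<open>\<rho>\<close>, maximise
  \<open>(4 * \<rho> - dist z y) ^ k * w y\<close> over the ball of radius \<open>4 * \<rho>\<close>, in the spirit of Keller and
  Osserman, and let \<open>M\<close> be the value of \<open>w\<close> and \<open>4 * r\<close> the distance to the boundary at the
  maximum point. On the ball of radius \<open>2 * r\<close> around this point \<open>w \<le> 2 ^ k * M\<close>, so a paraboloid of
  opening \<open>2 ^ k * M / r\<^sup>2\<close> touches \<open>w\<close> from above at a nearby point \<open>x\<close> with \<open>w x \<ge> M\<close>.
  At \<open>x\<close> the linear part of the paraboloid does not contribute to the principal value, by oddness, and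
  the far field is controlled by \<open>max 0 w \<le> M + w\<^sup>2 / M\<close> and the finite energy. The equation then
  gives \<open>2 * M\<^sup>2 + M ^ 4 \<le> D * (M\<^sup>2 * r powr - \<alpha> + r powr - (n + \<alpha>))\<close>, which contradicts
  \<open>M * r ^ k \<ge> w z * \<rho> ^ k\<close> for large \<open>\<rho>\<close>: the linear term on the left wins for large \<open>r\<close>, the cubic
  nonlinearity for small \<open>r\<close>.
\<close>

section \<open>Kernel integrals by dyadic decomposition\<close>

text \<open>Wherever \<open>f\<close> is nonzero, a single term of the series of \<open>c k\<close>
  times the indicator of \<open>cball 0 (\<rho> k)\<close> dominates it, so \<open>f\<close> lies
  below the whole series. Termwise integration leaves a geometric series in \<open>q\<close>. Full
  balls stand in for annuli, so no disjointness has to be tracked.\<close>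

lemma integral_shell_bound:
  fixes f :: "'a::euclidean_space \<Rightarrow> real"
  assumes f [measurable]: "f \<in> borel_measurable borel" and nonneg: "\<And>h. 0 \<le> f h"
    and q: "0 \<le> q" "q < 1" and c: "\<And>k. 0 \<le> c k" and \<rho>: "\<And>k. 0 \<le> \<rho> k"
    and B: "\<And>k. c k * \<rho> k ^ DIM('a) \<le> B * q ^ k"
    and cover: "\<And>h. f h \<noteq> 0 \<Longrightarrow> \<exists>k. norm h \<le> \<rho> k \<and> f h \<le> c k"
  shows "integrable lborel f"
    and "integral\<^sup>L lborel f \<le> unit_ball_vol (real DIM('a)) * B / (1 - q)"
proof -
  let ?V = "unit_ball_vol (real DIM('a))"
  have V: "0 \<le> ?V" by simp
  have "0 \<le> c 0 * \<rho> 0 ^ DIM('a)" using c \<rho> by simp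
  with B[of 0] have B0: "0 \<le> B" by simp
  have le_suminf: "g k \<le> suminf g" for g :: "nat \<Rightarrow> ennreal" and k
    using sum_le_suminf[of g "{k}"] by simp
  have pw: "ennreal (f h) \<le> (\<Sum>k. ennreal (c k) * indicator (cball 0 (\<rho> k)) h)" for h
  proof (cases "f h = 0")
    case False
    then obtain k where k: "norm h \<le> \<rho> k" "f h \<le> c k" using cover by blast
    then have "ennreal (f h) \<le> ennreal (c k) * indicator (cball 0 (\<rho> k)) h"
      by (auto intro: ennreal_leI)
    also have "\<dots> \<le> (\<Sum>k. ennreal (c k) * indicator (cball 0 (\<rho> k)) h)"
      by (rule le_suminf)
    finally show ?thesis .
  qed simp
  have sums: "(\<lambda>k. ?V * B * q ^ k) sums (?V * B * (1 / (1 - q)))"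
    using q by (intro sums_mult geometric_sums) auto
  have "(\<integral>\<^sup>+h. ennreal (f h) \<partial>lborel) \<le> (\<integral>\<^sup>+h. (\<Sum>k. ennreal (c k) * indicator (cball 0 (\<rho> k)) h) \<partial>(lborel :: 'a measure))"
    by (rule nn_integral_mono) (rule pw)
  also have "\<dots> = (\<Sum>k. \<integral>\<^sup>+h. ennreal (c k) * indicator (cball 0 (\<rho> k)) h \<partial>(lborel :: 'a measure))"
  proof (rule nn_integral_suminf)
    fix k
    have [measurable]: "cball (0::'a) (\<rho> k) \<in> sets borel" by simp
    show "(\<lambda>h::'a. ennreal (c k) * indicator (cball 0 (\<rho> k)) h) \<in> borel_measurable lborel"
      by measurable
  qed
  also have "\<dots> = (\<Sum>k. ennreal (c k * (?V * \<rho> k ^ DIM('a))))"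
    using c \<rho> by (simp add: nn_integral_cmult_indicator emeasure_cball ennreal_mult'')
  also have "\<dots> \<le> (\<Sum>k. ennreal (?V * B * q ^ k))"
  proof (intro suminf_le ennreal_leI)
    fix k show "c k * (?V * \<rho> k ^ DIM('a)) \<le> ?V * B * q ^ k"
      using mult_left_mono[OF B[of k] V] by (simp add: mult_ac)
  qed auto
  also have "\<dots> = ennreal (?V * B / (1 - q))"
    using sums_unique[OF sums] sums_summable[OF sums] B0 q V by (subst suminf_ennreal2) auto
  finally have le: "(\<integral>\<^sup>+h. ennreal (f h) \<partial>lborel) \<le> ennreal (?V * B / (1 - q))" .
  show int: "integrable lborel f"
    using le nonneg by (intro integrableI_nonneg) (auto simp: top_unique less_top[symmetric])
  have "ennreal (integral\<^sup>L lborel f) \<le> ennreal (?V * B / (1 - q))"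
    using le nn_integral_eq_integral[OF int] nonneg by simp
  then show "integral\<^sup>L lborel f \<le> ?V * B / (1 - q)"
    using B0 q V by (subst (asm) ennreal_le_iff) auto
qed

lemma dyadic_bracket:
  fixes t :: real
  assumes "1 \<le> t"
  obtains k :: nat where "2 ^ k \<le> t" "t < 2 ^ Suc k"
proof -
  have ex: "\<exists>m. t < 2 ^ m" by (rule real_arch_pow) simp
  define m where "m = (LEAST m. t < 2 ^ m)"
  have m: "t < 2 ^ m" unfolding m_def by (rule LeastI_ex[OF ex])
  with assms have "m \<noteq> 0" by (cases m) auto
  then obtain k where k: "m = Suc k" by (cases m) auto
  have "\<not> t < 2 ^ k" using not_less_Least[of k "\<lambda>m. t < 2 ^ m"] k unfolding m_def by auto
  with m k that show thesis by (auto simp: not_less)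
qed

text \<open>On the shell between the radii \<open>2 ^ k * r\<close> and \<open>2 ^ Suc k * r\<close>
  the kernel is at most its value at the inner radius. Times the volume of the outer ball this
  scales like \<open>(2 ^ k * r) powr - \<alpha>\<close>, a geometric sequence of ratio below 1
  because \<open>\<alpha>\<close> is positive.\<close>

lemma outer_kernel:
  fixes \<alpha> r :: real
  assumes "0 < \<alpha>" "0 < r"
  defines "f \<equiv> \<lambda>h::'a::euclidean_space. indicat_real {h. r < norm h} h / norm h powr (DIM('a) + \<alpha>)"
  shows "integrable lborel f"
    and "integral\<^sup>L lborel f \<le> unit_ball_vol (real DIM('a)) * 2 ^ DIM('a) / (1 - 2 powr - \<alpha>) * r powr - \<alpha>"
proof -
  let ?p = "real DIM('a) + \<alpha>"
  let ?c = "\<lambda>k. (2 ^ k * r) powr - ?p" and ?\<rho> = "\<lambda>k. 2 ^ Suc k * r"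
  have meas: "f \<in> borel_measurable borel" unfolding f_def by measurable
  have nn: "0 \<le> f h" for h by (simp add: f_def)
  have q: "0 \<le> 2 powr - \<alpha>" "2 powr - \<alpha> < (1::real)"
    using assms by (auto simp: powr_minus_divide)
  have B: "?c k * ?\<rho> k ^ DIM('a) \<le> 2 ^ DIM('a) * r powr - \<alpha> * (2 powr - \<alpha>) ^ k" for k
  proof -
    have s: "2 ^ k * r > 0" using assms by simp
    have "?c k * ?\<rho> k ^ DIM('a) = 2 ^ DIM('a) * ((2 ^ k * r) powr - ?p * (2 ^ k * r) powr real DIM('a))"
      using s by (subst powr_realpow) (auto simp: power_mult_distrib)
    also have "\<dots> = 2 ^ DIM('a) * (2 ^ k * r) powr - \<alpha>"
      by (simp add: powr_add[symmetric])
    also have "\<dots> = 2 ^ DIM('a) * r powr - \<alpha> * (2 powr - \<alpha>) ^ k"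
      using assms by (simp add: powr_mult powr_realpow[symmetric] powr_powr mult.commute)
    finally show ?thesis by simp
  qed
  have cover: "\<exists>k. norm h \<le> ?\<rho> k \<and> f h \<le> ?c k" if "f h \<noteq> 0" for h
  proof -
    have h: "r < norm h" using that by (auto simp: f_def indicator_def split: if_splits)
    then have "1 \<le> norm h / r" using assms by simp
    then obtain k where k: "2 ^ k \<le> norm h / r" "norm h / r < 2 ^ Suc k" by (rule dyadic_bracket)
    have "f h \<le> ?c k"
      using h k(1) assms(1,2) powr_mono2'[of "- ?p" "2 ^ k * r" "norm h"]
      by (simp add: f_def powr_minus_divide[symmetric] pos_le_divide_eq)
    moreover have "norm h \<le> ?\<rho> k" using k(2) assms by (simp add: pos_divide_less_eq)
    ultimately show ?thesis by blast
  qed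
  show "integrable lborel f"
    by (rule integral_shell_bound(1)[of f _ ?c ?\<rho>, OF meas nn q _ _ B cover]) (use assms in auto)
  show "integral\<^sup>L lborel f \<le> unit_ball_vol (real DIM('a)) * 2 ^ DIM('a) / (1 - 2 powr - \<alpha>) * r powr - \<alpha>"
    by (rule order.trans[OF integral_shell_bound(2)[of f _ ?c ?\<rho>, OF meas nn q _ _ B cover]]) (use assms in auto)
qed

text \<open>The shells now shrink towards the origin. The quadratic factor weakens the singularity,
  so the contributions have ratio \<open>2 powr (\<alpha> - 2)\<close>, which is below 1 because
  \<open>\<alpha> < 2\<close>.\<close>

lemma inner_kernel:
  fixes \<alpha> r :: real
  assumes "0 < \<alpha>" "\<alpha> < 2" "0 < r"
  defines "f \<equiv> \<lambda>h::'a::euclidean_space. indicat_real {h. norm h \<le> r} h * (norm h)\<^sup>2 / norm h powr (DIM('a) + \<alpha>)"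
  shows "integrable lborel f"
    and "integral\<^sup>L lborel f \<le> unit_ball_vol (real DIM('a)) * 2 powr (DIM('a) + \<alpha>) / (1 - 2 powr (\<alpha> - 2)) * r powr (2 - \<alpha>)"
proof -
  let ?p = "real DIM('a) + \<alpha>"
  let ?c = "\<lambda>k. (r / 2 ^ k)\<^sup>2 * (r / 2 ^ Suc k) powr - ?p" and ?\<rho> = "\<lambda>k. r / 2 ^ k"
  have meas: "f \<in> borel_measurable borel" unfolding f_def by measurable
  have nn: "0 \<le> f h" for h by (simp add: f_def)
  have q: "0 \<le> 2 powr (\<alpha> - 2)" "2 powr (\<alpha> - 2) < (1::real)"
    using assms by (auto simp: powr_less_one)
  have B: "?c k * ?\<rho> k ^ DIM('a) \<le> 2 powr ?p * r powr (2 - \<alpha>) * (2 powr (\<alpha> - 2)) ^ k" for k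
  proof -
    have s: "r / 2 ^ k > 0" using assms by simp
    have "r / 2 ^ Suc k = (r / 2 ^ k) * inverse 2" by (simp add: field_simps)
    then have e: "(r / 2 ^ Suc k) powr - ?p = (r / 2 ^ k) powr - ?p * 2 powr ?p"
      using s by (simp only: powr_mult inverse_powr powr_minus[of _ ?p]) (simp add: powr_minus)
    have "?c k * ?\<rho> k ^ DIM('a) = 2 powr ?p * ((r / 2 ^ k) powr 2 * (r / 2 ^ k) powr - ?p * (r / 2 ^ k) powr real DIM('a))"
      unfolding e using s by (simp add: powr_realpow)
    also have "\<dots> = 2 powr ?p * (r / 2 ^ k) powr (2 - \<alpha>)"
      by (simp add: powr_add[symmetric])
    also have "\<dots> = 2 powr ?p * (r powr (2 - \<alpha>) * (2 powr (\<alpha> - 2)) ^ k)"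
    proof -
      have "(r / 2 ^ k) powr (2 - \<alpha>) = r powr (2 - \<alpha>) / (2 powr real k) powr (2 - \<alpha>)"
        using assms by (simp add: powr_divide powr_realpow)
      also have "\<dots> = r powr (2 - \<alpha>) * 2 powr ((\<alpha> - 2) * real k)"
        by (simp add: powr_powr divide_inverse powr_minus[symmetric] left_diff_distrib right_diff_distrib mult.commute)
      also have "2 powr ((\<alpha> - 2) * real k) = (2 powr (\<alpha> - 2)) ^ k"
        by (simp add: powr_powr[symmetric] powr_realpow)
      finally show ?thesis by simp
    qed
    finally show ?thesis by simp
  qed
  have cover: "\<exists>k. norm h \<le> ?\<rho> k \<and> f h \<le> ?c k" if "f h \<noteq> 0" for h
  proof -
    \<comment> \<open>The origin lies in no shell, but \<open>f\<close> vanishes there.\<close>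
    have h: "norm h \<le> r" "0 < norm h" using that by (auto simp: f_def indicator_def split: if_splits)
    then have "1 \<le> r / norm h" by simp
    then obtain k where k: "2 ^ k \<le> r / norm h" "r / norm h < 2 ^ Suc k" by (rule dyadic_bracket)
    have n: "norm h \<le> ?\<rho> k" using k(1) h by (simp add: field_simps)
    have l: "r / 2 ^ Suc k \<le> norm h" using k(2) h by (simp add: field_simps)
    have "f h = (norm h)\<^sup>2 * norm h powr - ?p" using h by (simp add: f_def powr_minus[of _ ?p] divide_inverse del: minus_add_distrib)
    also have "\<dots> \<le> ?c k"
      using n l h assms by (intro mult_mono power_mono powr_mono2') auto
    finally show ?thesis using n by blast
  qed
  show "integrable lborel f"
    by (rule integral_shell_bound(1)[of f _ ?c ?\<rho>, OF meas nn q _ _ B cover]) (use assms in auto)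
  show "integral\<^sup>L lborel f \<le> unit_ball_vol (real DIM('a)) * 2 powr (DIM('a) + \<alpha>) / (1 - 2 powr (\<alpha> - 2)) * r powr (2 - \<alpha>)"
    by (rule order.trans[OF integral_shell_bound(2)[of f _ ?c ?\<rho>, OF meas nn q _ _ B cover]]) (use assms in auto)
qed

section \<open>Unit-Jacobian substitutions and odd cancellation\<close>

text \<open>The assumption leaves \<open>c = 1\<close> and \<open>c = -1\<close>, that is,
  translations and point reflections, whose Jacobian factor is 1.\<close>

lemma lborel_affine_unit:
  fixes t :: "'a::euclidean_space"
  assumes "\<bar>c\<bar> = 1"
  shows "distr lborel borel (\<lambda>x. t + c *\<^sub>R x) = lborel"
proof -
  have "lborel = density (distr lborel borel (\<lambda>x. t + c *\<^sub>R x)) (\<lambda>_. 1)"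
    using lborel_affine[of c t] assms by (auto simp: abs_if split: if_splits)
  then show ?thesis by (simp add: density_1)
qed

lemma lborel_affine_unit_integral:
  fixes f :: "'a::euclidean_space \<Rightarrow> real" and t :: 'a
  assumes [measurable]: "f \<in> borel_measurable borel" and c: "\<bar>c\<bar> = 1"
  shows "integrable lborel (\<lambda>x. f (t + c *\<^sub>R x)) \<longleftrightarrow> integrable lborel f"
    and "integral\<^sup>L lborel (\<lambda>x. f (t + c *\<^sub>R x)) = integral\<^sup>L lborel f"
proof -
  show "integrable lborel (\<lambda>x. f (t + c *\<^sub>R x)) \<longleftrightarrow> integrable lborel f"
    by (subst (2) lborel_affine_unit[OF c, of t, symmetric], subst integrable_distr_eq) auto
  show "integral\<^sup>L lborel (\<lambda>x. f (t + c *\<^sub>R x)) = integral\<^sup>L lborel f"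
    by (subst (2) lborel_affine_unit[OF c, of t, symmetric], subst integral_distr) auto
qed

text \<open>The integrand is bounded on a bounded annulus away from the origin, hence integrable,
  and the reflection of \<open>h\<close> to \<open>- h\<close> changes its sign.\<close>

lemma odd_kernel:
  fixes v :: "'a::euclidean_space" and \<epsilon> r p :: real
  assumes "0 < \<epsilon>" "0 \<le> p"
  defines "f \<equiv> \<lambda>h. indicat_real {h. \<epsilon> < norm h \<and> norm h \<le> r} h * (v \<bullet> h) / norm h powr p"
  shows "integrable lborel f" and "integral\<^sup>L lborel f = 0"
proof -
  have meas [measurable]: "f \<in> borel_measurable borel" unfolding f_def by measurable
  show "integrable lborel f"
  proof (rule Bochner_Integration.integrable_bound)
    show "integrable lborel (\<lambda>h::'a. indicat_real (cball 0 r) h * (norm v * \<bar>r\<bar> / \<epsilon> powr p))"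
      by (intro integrable_mult_left integrable_real_indicator) (use emeasure_lborel_cball_finite[of 0 r] in auto)
    show "AE h in lborel. norm (f h) \<le> norm (indicat_real (cball 0 r) h * (norm v * \<bar>r\<bar> / \<epsilon> powr p))"
    proof (rule AE_I2)
      fix h :: 'a
      show "norm (f h) \<le> norm (indicat_real (cball 0 r) h * (norm v * \<bar>r\<bar> / \<epsilon> powr p))"
      proof (cases "\<epsilon> < norm h \<and> norm h \<le> r")
        case True
        have "\<bar>v \<bullet> h\<bar> \<le> norm v * norm h" by (rule Cauchy_Schwarz_ineq2)
        also have "\<dots> \<le> norm v * \<bar>r\<bar>" using True by (intro mult_left_mono) auto
        finally have "\<bar>v \<bullet> h\<bar> / norm h powr p \<le> norm v * \<bar>r\<bar> / \<epsilon> powr p"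
          using True assms by (intro frac_le powr_mono2) auto
        then show ?thesis using True by (simp add: f_def)
      qed (auto simp: f_def)
    qed
  qed measurable
  have "f (0 + (-1) *\<^sub>R h) = - f h" for h by (simp add: f_def indicator_def)
  then have "integral\<^sup>L lborel f = integral\<^sup>L lborel (\<lambda>h. - f h)"
    using lborel_affine_unit_integral(2)[OF meas, of "-1" 0] by simp
  then show "integral\<^sup>L lborel f = 0" by simp
qed


section \<open>Consequences of local C^{1,1} regularity\<close>

lemma C11_loc_continuous:
  assumes "u \<in> C11_loc"
  shows "continuous_on UNIV u"
proof -
  from assms obtain Du where Du: "\<And>x. GDERIV u x :> Du x" unfolding C11_loc_def by blast
  show ?thesis
    by (rule has_derivative_continuous_on) (use Du in \<open>simp add: gderiv_def\<close>)
qed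

text \<open>The mean value inequality is applied to \<open>u\<close> minus its linearisation at
  \<open>x\<close>: its gradient at \<open>y\<close> is \<open>Du y - Du x\<close>, of size at most
  \<open>L * norm h\<close> on \<open>cball x (norm h)\<close>. Halving the Lipschitz radius keeps
  this closed ball inside the open one.\<close>

lemma C11_loc_Taylor:
  fixes u :: "'a::euclidean_space \<Rightarrow> real"
  assumes "u \<in> C11_loc"
  obtains v r L where "0 < r"
    "\<And>h. norm h \<le> r \<Longrightarrow> \<bar>u x - u (x + h) + v \<bullet> h\<bar> \<le> L * (norm h)\<^sup>2"
proof -
  from assms obtain Du where Du: "\<And>x. GDERIV u x :> Du x"
    and lip: "\<exists>r>0. \<exists>L. L-lipschitz_on (ball x r) Du"
    unfolding C11_loc_def by blast
  from lip obtain r L where r: "0 < r" and L: "L-lipschitz_on (ball x r) Du" by blast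
  have "\<bar>u x - u (x + h) + Du x \<bullet> h\<bar> \<le> L * (norm h)\<^sup>2" if h: "norm h \<le> r / 2" for h
  proof -
    let ?f = "\<lambda>y. u y - Du x \<bullet> (y - x)"
    have "norm (?f (x + h) - ?f x) \<le> (L * norm h) * norm ((x + h) - x)"
    proof (rule differentiable_bound)
      show "convex (cball x (norm h))" by simp
      fix y assume y: "y \<in> cball x (norm h)"
      show "(?f has_derivative (\<lambda>k. (Du y - Du x) \<bullet> k)) (at y within cball x (norm h))"
      proof (rule has_derivative_at_withinI)
        have "((\<lambda>y. y - x) has_derivative (\<lambda>k. k)) (at y)"
          by (auto intro!: derivative_eq_intros)
        from has_derivative_diff[OF Du[of y, unfolded gderiv_def]
            bounded_linear.has_derivative[OF bounded_linear_inner_right this, of "Du x"]]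
        show "(?f has_derivative (\<lambda>k. (Du y - Du x) \<bullet> k)) (at y)"
          by (simp add: inner_diff_left inner_diff_right inner_commute)
      qed
      have "onorm (\<lambda>k. (Du y - Du x) \<bullet> k) \<le> norm (Du y - Du x)"
        by (rule onorm_bound) (auto intro: order.trans[OF Cauchy_Schwarz_ineq2])
      also have "\<dots> \<le> L * dist y x"
        using lipschitz_onD[OF L, of y x] y h r by (simp add: dist_norm norm_minus_commute)
      also have "\<dots> \<le> L * norm h"
        using y lipschitz_on_nonneg[OF L] by (intro mult_left_mono) (auto simp: dist_commute)
      finally show "onorm (\<lambda>k. (Du y - Du x) \<bullet> k) \<le> L * norm h" .
    qed (auto simp: dist_norm)
    then have "\<bar>u (x + h) - Du x \<bullet> h - u x\<bar> \<le> L * (norm h)\<^sup>2"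
      by (simp add: power2_eq_square mult.assoc)
    then show ?thesis by linarith
  qed
  with r that[of "r / 2"] show thesis by auto
qed

section \<open>Truncated integrals and the principal value\<close>

text \<open>Borel measurability allows passing from \<open>lebesgue\<close> to
  \<open>lborel\<close>, where the substitution \<open>y = x + h\<close> centres the singularity at
  the origin.\<close>

lemma truncated_integral_translate:
  fixes u :: "'a::euclidean_space \<Rightarrow> real"
  assumes [measurable]: "u \<in> borel_measurable borel"
  shows "(LINT y:{y. norm (x - y) > \<epsilon>}|lebesgue. (u x - u y) / norm (x - y) powr p)
    = (LINT h|lborel. indicat_real {h. \<epsilon> < norm h} h * ((u x - u (x + h)) / norm h powr p))"
proof -
  let ?f = "\<lambda>y. indicat_real {y. norm (x - y) > \<epsilon>} y * ((u x - u y) / norm (x - y) powr p)"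
  have meas: "?f \<in> borel_measurable borel" by measurable
  have "(LINT y:{y. norm (x - y) > \<epsilon>}|lebesgue. (u x - u y) / norm (x - y) powr p) = integral\<^sup>L lborel ?f"
    using meas unfolding set_lebesgue_integral_def by (simp add: integral_completion)
  also have "\<dots> = (LINT h|lborel. ?f (x + 1 *\<^sub>R h))"
    by (rule lborel_affine_unit_integral(2)[OF meas, symmetric]) simp
  finally show ?thesis by (simp add: indicator_def)
qed

text \<open>Away from the singularity \<open>norm h powr (DIM('a) + \<alpha>)\<close> is comparable
  from below with the weight of \<open>L_weighted\<close> at \<open>x + h\<close>. The part with
  \<open>u x\<close> is handled by \<open>outer_kernel\<close>, the part with
  \<open>u (x + h)\<close> by the weighted integrability.\<close>

lemma truncated_integrand_integrable:
  fixes u :: "'a::euclidean_space \<Rightarrow> real" and \<alpha> :: real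
  assumes cont: "continuous_on UNIV u" and u: "u \<in> L_weighted \<alpha>" and "0 < \<alpha>" "0 < \<epsilon>"
  shows "integrable lborel (\<lambda>h. indicat_real {h. \<epsilon> < norm h} h * ((u x - u (x + h)) / norm h powr (DIM('a) + \<alpha>)))"
proof -
  let ?p = "real DIM('a) + \<alpha>"
  have [measurable]: "u \<in> borel_measurable borel"
    using cont by (rule borel_measurable_continuous_onI)
  let ?w = "\<lambda>y. \<bar>u y\<bar> / (1 + norm y powr ?p)"
  have wm: "?w \<in> borel_measurable borel" by measurable
  have "integrable lborel ?w"
    using u wm unfolding L_weighted_def by (simp add: integrable_completion)
  then have w: "integrable lborel (\<lambda>h. ?w (x + h))"
    using lborel_affine_unit_integral(1)[OF wm, of 1 x] by simp
  \<comment> \<open>For \<open>norm h > \<epsilon>\<close> the first summand absorbs the 1 in the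
    weight, and the second comes from
    \<open>norm (x + h) \<le> (norm x / \<epsilon> + 1) * norm h\<close>.\<close>
  define C where "C = 1 / \<epsilon> powr ?p + (norm x / \<epsilon> + 1) powr ?p"
  let ?k = "\<lambda>h::'a. indicat_real {h. \<epsilon> < norm h} h / norm h powr ?p"
  have bound: "integrable lborel (\<lambda>h. \<bar>u x\<bar> * ?k h + C * ?w (x + h))"
    using w outer_kernel(1)[OF \<open>0 < \<alpha>\<close> \<open>0 < \<epsilon>\<close>, where ?'a = 'a]
    by (intro Bochner_Integration.integrable_add integrable_mult_right) auto
  show ?thesis
  proof (rule Bochner_Integration.integrable_bound[OF bound])
    show "AE h in lborel. norm (indicat_real {h. \<epsilon> < norm h} h * ((u x - u (x + h)) / norm h powr ?p))
        \<le> norm (\<bar>u x\<bar> * ?k h + C * ?w (x + h))"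
    proof (rule AE_I2)
      fix h :: 'a
      have C0: "0 \<le> C" by (simp add: C_def)
      have w0: "0 \<le> ?w (x + h)" by (simp add: add_nonneg_nonneg)
      show "norm (indicat_real {h. \<epsilon> < norm h} h * ((u x - u (x + h)) / norm h powr ?p))
        \<le> norm (\<bar>u x\<bar> * ?k h + C * ?w (x + h))"
      proof (cases "\<epsilon> < norm h")
        case True
        have hp: "0 < norm h powr ?p" using True \<open>0 < \<epsilon>\<close> by auto
        have "norm (x + h) \<le> norm x * 1 + norm h" using norm_triangle_ineq[of x h] by simp
        also have "\<dots> \<le> norm x * (norm h / \<epsilon>) + norm h"
          using True \<open>0 < \<epsilon>\<close> by (intro add_right_mono mult_left_mono) auto
        also have "\<dots> = (norm x / \<epsilon> + 1) * norm h" by (simp add: algebra_simps)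
        finally have "norm (x + h) powr ?p \<le> ((norm x / \<epsilon> + 1) * norm h) powr ?p"
          using \<open>0 < \<alpha>\<close> by (intro powr_mono2) auto
        also have "\<dots> = (norm x / \<epsilon> + 1) powr ?p * norm h powr ?p"
          by (rule powr_mult)
        finally have a: "norm (x + h) powr ?p \<le> (norm x / \<epsilon> + 1) powr ?p * norm h powr ?p" .
        have "\<epsilon> powr ?p \<le> norm h powr ?p" using True \<open>0 < \<alpha>\<close> \<open>0 < \<epsilon>\<close> by (intro powr_mono2) auto
        then have "1 \<le> 1 / \<epsilon> powr ?p * norm h powr ?p" using \<open>0 < \<epsilon>\<close> by (simp add: pos_le_divide_eq)
        with a have le: "1 + norm (x + h) powr ?p \<le> C * norm h powr ?p"
          unfolding C_def distrib_right by linarith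
        have "0 < 1 + norm (x + h) powr ?p" by (simp add: add_pos_nonneg)
        then have "1 / norm h powr ?p \<le> C / (1 + norm (x + h) powr ?p)"
          using le hp by (simp add: divide_simps mult.commute)
        from mult_left_mono[OF this, of "\<bar>u (x + h)\<bar>"]
        have "\<bar>u (x + h)\<bar> / norm h powr ?p \<le> C * ?w (x + h)" by (simp add: mult.commute)
        moreover have "\<bar>u x - u (x + h)\<bar> / norm h powr ?p \<le> \<bar>u x\<bar> / norm h powr ?p + \<bar>u (x + h)\<bar> / norm h powr ?p"
          using hp by (simp add: add_divide_distrib[symmetric] divide_right_mono)
        ultimately have "\<bar>u x - u (x + h)\<bar> / norm h powr ?p \<le> \<bar>u x\<bar> * ?k h + C * ?w (x + h)"
          using True by simp
        then show ?thesis using True by simp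
      next
        case False
        then show ?thesis by simp
      qed
    qed
  qed measurable
qed

text \<open>
  The linear term is chosen differently in two places: the gradient of \<open>u\<close> gives convergence of the
  principal value, the slope of a touching paraboloid gives the one-sided bound.
\<close>

lemma truncated_integral_linear_correction:
  fixes u :: "'a::euclidean_space \<Rightarrow> real" and x v :: 'a and \<alpha> \<epsilon> r :: real
  assumes cont: "continuous_on UNIV u" and u: "u \<in> L_weighted \<alpha>" and "0 < \<alpha>" "0 < \<epsilon>"
  defines "G \<equiv> \<lambda>h. (u x - u (x + h) + indicat_real {h. norm h \<le> r} h * (v \<bullet> h)) / norm h powr (DIM('a) + \<alpha>)"
  shows "integrable lborel (\<lambda>h. indicat_real {h. \<epsilon> < norm h} h * G h)"
    and "(LINT h|lborel. indicat_real {h. \<epsilon> < norm h} h * ((u x - u (x + h)) / norm h powr (DIM('a) + \<alpha>)))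
      = (LINT h|lborel. indicat_real {h. \<epsilon> < norm h} h * G h)"
proof -
  let ?T = "\<lambda>h. indicat_real {h. \<epsilon> < norm h} h * ((u x - u (x + h)) / norm h powr (DIM('a) + \<alpha>))"
  let ?O = "\<lambda>h. indicat_real {h. \<epsilon> < norm h \<and> norm h \<le> r} h * (v \<bullet> h) / norm h powr (DIM('a) + \<alpha>)"
  have eq: "(\<lambda>h. indicat_real {h. \<epsilon> < norm h} h * G h) = (\<lambda>h. ?T h + ?O h)"
    by (auto simp: G_def indicator_def add_divide_distrib fun_eq_iff)
  have O: "integrable lborel ?O" "integral\<^sup>L lborel ?O = 0"
    using odd_kernel[of \<epsilon> "real DIM('a) + \<alpha>" r v] assms(3,4) by auto
  have T: "integrable lborel ?T" using truncated_integrand_integrable assms(1-4) by blast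
  show "integrable lborel (\<lambda>h. indicat_real {h. \<epsilon> < norm h} h * G h)"
    unfolding eq by (intro Bochner_Integration.integrable_add T O)
  show "integral\<^sup>L lborel ?T = (LINT h|lborel. indicat_real {h. \<epsilon> < norm h} h * G h)"
    unfolding eq by (subst Bochner_Integration.integral_add[OF T O(1)]) (simp add: O(2))
qed

text \<open>This ties \<open>Lim\<close> to an actual limit. Once the linear term is added, the
  integrand is dominated independently of the truncation: by the Taylor bound near the origin and by
  the absolutely integrable tail outside. Dominated convergence along sequences then gives the
  limit.\<close>

lemma frac_laplacian_limit:
  fixes u :: "'a::euclidean_space \<Rightarrow> real" and \<alpha> :: real
  assumes \<alpha>: "0 < \<alpha>" "\<alpha> < 2" and u: "u \<in> C11_loc \<inter> L_weighted \<alpha>"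
  obtains l where
    "((\<lambda>\<epsilon>. LINT y:{y. norm (x - y) > \<epsilon>}|lebesgue. (u x - u y) / norm (x - y) powr (DIM('a) + \<alpha>))
       \<longlongrightarrow> l) (at_right 0)"
    "frac_laplacian \<alpha> u x = frac_const DIM('a) \<alpha> * l"
proof -
  let ?p = "real DIM('a) + \<alpha>"
  have cont: "continuous_on UNIV u" using u C11_loc_continuous by blast
  have uC: "u \<in> C11_loc" and uL: "u \<in> L_weighted \<alpha>" using u by auto
  have [measurable]: "u \<in> borel_measurable borel"
    using cont by (rule borel_measurable_continuous_onI)
  obtain v r L where r: "0 < r"
    and Taylor: "\<And>h. norm h \<le> r \<Longrightarrow> \<bar>u x - u (x + h) + v \<bullet> h\<bar> \<le> L * (norm h)\<^sup>2"
    by (rule C11_loc_Taylor[OF uC, of x], rule that)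
  define G where "G \<equiv> \<lambda>h. (u x - u (x + h) + indicat_real {h. norm h \<le> r} h * (v \<bullet> h)) / norm h powr ?p"
  let ?i = "\<lambda>h::'a. indicat_real {h. norm h \<le> r} h * (norm h)\<^sup>2 / norm h powr ?p"
  let ?o = "\<lambda>h. indicat_real {h. r < norm h} h * ((u x - u (x + h)) / norm h powr ?p)"
  let ?W = "\<lambda>h. L * ?i h + \<bar>?o h\<bar>"
  have W: "integrable lborel ?W"
    using inner_kernel(1)[OF \<alpha> r, where ?'a = 'a] truncated_integrand_integrable[OF cont uL \<alpha>(1) r, of x]
    by (intro Bochner_Integration.integrable_add integrable_mult_right integrable_abs) auto
  have GW: "\<bar>G h\<bar> \<le> ?W h" for h
  proof (cases "norm h \<le> r")
    case True
    then show ?thesis using Taylor[OF True] by (auto simp: G_def intro!: divide_right_mono)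
  qed (simp add: G_def)
  have Gm [measurable]: "G \<in> borel_measurable borel" unfolding G_def by measurable
  let ?F = "\<lambda>\<epsilon>. LINT y:{y. norm (x - y) > \<epsilon>}|lebesgue. (u x - u y) / norm (x - y) powr ?p"
  have lim: "(?F \<longlongrightarrow> integral\<^sup>L lborel G) (at_right 0)"
    unfolding tendsto_at_iff_sequentially
  proof (intro allI impI)
    fix X :: "nat \<Rightarrow> real"
    assume X: "\<forall>i. X i \<in> {0<..} - {0}" "X \<longlonglongrightarrow> 0"
    have "?F (X i) = (LINT h|lborel. indicat_real {h. X i < norm h} h * G h)" for i
      using truncated_integral_linear_correction(2)[OF cont uL \<alpha>(1), of "X i" x r v] X(1)
      by (simp add: truncated_integral_translate G_def)
    then have "(?F \<circ> X) = (\<lambda>i. LINT h|lborel. indicat_real {h. X i < norm h} h * G h)" by auto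
    also have "\<dots> \<longlonglongrightarrow> integral\<^sup>L lborel G"
    proof (rule integral_dominated_convergence[where w = ?W])
      show "AE h in lborel. (\<lambda>i. indicat_real {h. X i < norm h} h * G h) \<longlonglongrightarrow> G h"
      proof (rule AE_I2)
        fix h
        show "(\<lambda>i. indicat_real {h. X i < norm h} h * G h) \<longlonglongrightarrow> G h"
        \<comment> \<open>At the origin both sides vanish, since the numerator of \<open>G\<close>
          is 0 there; any other point is eventually outside the truncation.\<close>
        proof (cases "h = 0")
          case False
          then have "\<forall>\<^sub>F i in sequentially. X i < norm h" by (intro order_tendstoD(2)[OF X(2)]) simp
          then have "\<forall>\<^sub>F i in sequentially. G h = indicat_real {h. X i < norm h} h * G h"
            by eventually_elim simp
          then show ?thesis by (rule Lim_transform_eventually[OF tendsto_const])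
        qed (simp add: G_def)
      qed
      show "AE h in lborel. norm (indicat_real {h. X i < norm h} h * G h) \<le> ?W h" for i
      proof (rule AE_I2)
        fix h
        have "norm (indicat_real {h. X i < norm h} h * G h) \<le> \<bar>G h\<bar>" by (auto simp: indicator_def)
        then show "norm (indicat_real {h. X i < norm h} h * G h) \<le> ?W h" using GW[of h] by linarith
      qed
    qed (use W in auto)
    finally show "(?F \<circ> X) \<longlonglongrightarrow> integral\<^sup>L lborel G" .
  qed
  moreover have "frac_laplacian \<alpha> u x = frac_const DIM('a) \<alpha> * integral\<^sup>L lborel G"
    unfolding frac_laplacian_def using tendsto_Lim[OF _ lim] by simp
  ultimately show thesis by (rule that)
qed

section \<open>Sign of the constant and symmetry under negation\<close>

lemma frac_const_nonneg: "0 < \<alpha> \<Longrightarrow> 0 \<le> frac_const n \<alpha>"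
  unfolding frac_const_def by (auto intro!: divide_nonneg_nonneg mult_nonneg_nonneg less_imp_le[OF Gamma_real_pos])

text \<open>Negation passes through \<open>Lim\<close> because the limit for \<open>u\<close>
  exists. As the nonlinearity is odd, \<open>- u\<close> then solves the same equation, which turns
  the upper bound on solutions into a lower one.\<close>

lemma frac_laplacian_uminus:
  fixes u :: "'a::euclidean_space \<Rightarrow> real" and \<alpha> :: real
  assumes \<alpha>: "0 < \<alpha>" "\<alpha> < 2" and u: "u \<in> C11_loc \<inter> L_weighted \<alpha>"
  shows "frac_laplacian \<alpha> (\<lambda>y. - u y) x = - frac_laplacian \<alpha> u x"
proof -
  obtain l where l: "((\<lambda>\<epsilon>. LINT y:{y. norm (x - y) > \<epsilon>}|lebesgue. (u x - u y) / norm (x - y) powr (DIM('a) + \<alpha>))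
       \<longlongrightarrow> l) (at_right 0)"
    "frac_laplacian \<alpha> u x = frac_const DIM('a) \<alpha> * l"
    using frac_laplacian_limit[OF assms] by blast
  have "(- u x - - u y) / c = - ((u x - u y) / c)" for y c by (simp add: minus_divide_left)
  then have lim: "((\<lambda>\<epsilon>. LINT y:{y. norm (x - y) > \<epsilon>}|lebesgue. (- u x - - u y) / norm (x - y) powr (DIM('a) + \<alpha>))
       \<longlongrightarrow> - l) (at_right 0)"
    using tendsto_minus[OF l(1)] unfolding set_lebesgue_integral_def by simp
  then show ?thesis
    unfolding frac_laplacian_def[of \<alpha> "\<lambda>y. - u y"] l(2) using tendsto_Lim[OF _ lim] by simp
qed

lemma uminus_C11_L_weighted:
  assumes "u \<in> C11_loc \<inter> L_weighted \<alpha>"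
  shows "(\<lambda>y. - u y) \<in> C11_loc \<inter> L_weighted \<alpha>"
proof -
  from assms obtain Du where Du: "\<And>x. GDERIV u x :> Du x" "continuous_on UNIV Du"
    "\<And>x. \<exists>r>0. \<exists>L. L-lipschitz_on (ball x r) Du"
    unfolding C11_loc_def by blast
  have "GDERIV (\<lambda>y. - u y) x :> - Du x" for x
    by (rule GDERIV_minus[OF Du(1)])
  moreover have "continuous_on UNIV (\<lambda>x. - Du x)" by (intro continuous_on_minus Du(2))
  moreover have "\<exists>r>0. \<exists>L. L-lipschitz_on (ball x r) (\<lambda>x. - Du x)" for x
    using Du(3)[of x] by (simp add: lipschitz_on_minus_iff)
  ultimately have "(\<lambda>y. - u y) \<in> C11_loc"
    unfolding C11_loc_def mem_Collect_eq by (intro exI[of _ "\<lambda>x. - Du x"]) auto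
  moreover have "(\<lambda>y. - u y) \<in> L_weighted \<alpha>"
    using assms unfolding L_weighted_def L1_loc_def set_integrable_def by simp
  ultimately show ?thesis by blast
qed

section \<open>One-sided bound at a touching point\<close>

text \<open>The three terms are the paraboloid on the ball of radius \<open>r\<close>, the constant
  part of the far field and its energy part. The constant \<open>C\<close> depends only on the
  dimension, \<open>\<alpha>\<close> and the energy of \<open>u\<close>, so \<open>x\<close>,
  \<open>\<mu>\<close>, \<open>v\<close>, \<open>r\<close> and \<open>\<delta>\<close> can all be
  chosen afterwards.\<close>

lemma frac_laplacian_lower_bound:
  fixes u :: "'a::euclidean_space \<Rightarrow> real" and \<alpha> :: real
  assumes \<alpha>: "0 < \<alpha>" "\<alpha> < 2" and u: "u \<in> C11_loc \<inter> L_weighted \<alpha>"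
    and int: "integrable lebesgue (\<lambda>x. (1 - \<bar>u x\<bar>\<^sup>2)\<^sup>2)"
  obtains C where "0 \<le> C"
    "\<And>x \<mu> v r \<delta>. \<lbrakk>0 \<le> \<mu>; 0 < r; 0 < \<delta>; 1 \<le> u x;
       \<And>h. norm h \<le> r \<Longrightarrow> u (x + h) - u x \<le> \<mu> * (norm h)\<^sup>2 + v \<bullet> h\<rbrakk>
     \<Longrightarrow> - frac_laplacian \<alpha> u x
       \<le> C * (\<mu> * r powr (2 - \<alpha>) + \<delta> * r powr - \<alpha> + r powr - (DIM('a) + \<alpha>) / \<delta>)"
proof -
  let ?p = "real DIM('a) + \<alpha>"
  have cont: "continuous_on UNIV u" using u C11_loc_continuous by blast
  have uL: "u \<in> L_weighted \<alpha>" using u by blast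
  have [measurable]: "u \<in> borel_measurable borel"
    using cont by (rule borel_measurable_continuous_onI)
  define e where "e = (\<lambda>y. (1 - \<bar>u y\<bar>\<^sup>2)\<^sup>2)"
  have em: "e \<in> borel_measurable borel" unfolding e_def by measurable
  have ei: "integrable lborel e" using int em unfolding e_def by (simp add: integrable_completion)
  define I where "I = integral\<^sup>L lborel e"
  have I0: "0 \<le> I" unfolding I_def e_def by (simp add: integral_nonneg_AE)
  have es: "integrable lborel (\<lambda>h. e (x + h))" "(LINT h|lborel. e (x + h)) = I" for x
    using lborel_affine_unit_integral[OF em, of 1 x] ei by (auto simp: I_def)
  define A where "A = unit_ball_vol (real DIM('a)) * 2 ^ DIM('a) / (1 - 2 powr - \<alpha>)"
  define B where "B = unit_ball_vol (real DIM('a)) * 2 powr (DIM('a) + \<alpha>) / (1 - 2 powr (\<alpha> - 2))"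
  have "0 \<le> 1 - 2 powr - \<alpha>" "0 \<le> 1 - 2 powr (\<alpha> - 2)"
    using powr_less_mono[of "- \<alpha>" 0 2] powr_less_mono[of "\<alpha> - 2" 0 2] \<alpha> by simp_all
  then have AB: "0 \<le> A" "0 \<le> B" unfolding A_def B_def by simp_all
  define C where "C = frac_const DIM('a) \<alpha> * (A + B + I)"
  have "- frac_laplacian \<alpha> u x
       \<le> C * (\<mu> * r powr (2 - \<alpha>) + \<delta> * r powr - \<alpha> + r powr - ?p / \<delta>)"
    if \<mu>: "0 \<le> \<mu>" and r: "0 < r" and \<delta>: "0 < \<delta>" and x: "1 \<le> u x"
      and touch: "\<And>h. norm h \<le> r \<Longrightarrow> u (x + h) - u x \<le> \<mu> * (norm h)\<^sup>2 + v \<bullet> h"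
    for x \<mu> v r \<delta>
  proof -
    let ?S = "\<mu> * r powr (2 - \<alpha>) + \<delta> * r powr - \<alpha> + r powr - ?p / \<delta>"
    let ?i = "\<lambda>h::'a. indicat_real {h. norm h \<le> r} h * (norm h)\<^sup>2 / norm h powr ?p"
    let ?o = "\<lambda>h::'a. indicat_real {h. r < norm h} h / norm h powr ?p"
    define G where "G \<equiv> \<lambda>h. (u x - u (x + h) + indicat_real {h. norm h \<le> r} h * (v \<bullet> h)) / norm h powr ?p"
    let ?R = "\<lambda>h. \<mu> * ?i h + \<delta> * ?o h + r powr - ?p / \<delta> * e (x + h)"
    have Ri: "integrable lborel ?R"
      using inner_kernel(1)[OF \<alpha> r, where ?'a = 'a] outer_kernel(1)[OF \<alpha>(1) r, where ?'a = 'a] es(1)[of x]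
      by (intro Bochner_Integration.integrable_add integrable_mult_right) auto
    have linear: "(LINT h|lborel. a * f h + b * g h + c * k h)
        = a * integral\<^sup>L lborel f + b * integral\<^sup>L lborel g + c * integral\<^sup>L lborel k"
      if "integrable lborel f" "integrable lborel g" "integrable lborel k" for a b c and f g k :: "'a \<Rightarrow> real"
      using that by simp
    have "integral\<^sup>L lborel ?R = \<mu> * integral\<^sup>L lborel ?i + \<delta> * integral\<^sup>L lborel ?o + r powr - ?p / \<delta> * I"
      using inner_kernel(1)[OF \<alpha> r, where ?'a = 'a] outer_kernel(1)[OF \<alpha>(1) r, where ?'a = 'a] es[of x]
      by (subst linear) auto
    also have "\<dots> \<le> \<mu> * (B * r powr (2 - \<alpha>)) + \<delta> * (A * r powr - \<alpha>) + r powr - ?p / \<delta> * I"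
      using inner_kernel(2)[OF \<alpha> r, where ?'a = 'a] outer_kernel(2)[OF \<alpha>(1) r, where ?'a = 'a] \<mu> \<delta>
      by (intro add_right_mono add_mono mult_left_mono) (auto simp: A_def B_def)
    also have "\<dots> = B * (\<mu> * r powr (2 - \<alpha>)) + A * (\<delta> * r powr - \<alpha>) + I * (r powr - ?p / \<delta>)"
      by (simp add: mult_ac)
    also have "\<dots> \<le> (A + B + I) * (\<mu> * r powr (2 - \<alpha>)) + (A + B + I) * (\<delta> * r powr - \<alpha>) + (A + B + I) * (r powr - ?p / \<delta>)"
      using AB I0 \<mu> \<delta> by (intro add_mono mult_right_mono) auto
    finally have R: "integral\<^sup>L lborel ?R \<le> (A + B + I) * ?S" by (simp only: distrib_left)
    \<comment> \<open>Since \<open>?R\<close> is nonnegative, the bound survives any truncation,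
      uniformly in \<open>\<epsilon>\<close>.\<close>
    have pw: "- (indicat_real {h. \<epsilon> < norm h} h * G h) \<le> ?R h" for \<epsilon> h
    proof -
      have e0: "0 \<le> e y" for y by (simp add: e_def)
      have R0: "0 \<le> ?R h" using \<mu> \<delta> e0 by simp
      have "- G h \<le> ?R h"
      proof (cases "norm h \<le> r")
        case True
        have "- G h = (u (x + h) - u x - v \<bullet> h) / norm h powr ?p"
          using True by (simp add: G_def minus_divide_left)
        also have "\<dots> \<le> (\<mu> * (norm h)\<^sup>2) / norm h powr ?p"
          using touch[OF True] by (intro divide_right_mono) auto
        also have "\<dots> \<le> ?R h" using True \<delta> e0 by simp
        finally show ?thesis .
      next
        case False
        let ?w = "max 0 (u (x + h) - 1)"
        have "?w\<^sup>2 \<le> e (x + h)"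
        proof (cases "1 \<le> u (x + h)")
          case True
          \<comment> \<open>The energy density factors as \<open>(u - 1)^2 * (1 + u)^2\<close>, and
            the second factor is at least 1 here.\<close>
          have "(u (x + h) - 1)\<^sup>2 * 1 \<le> (u (x + h) - 1)\<^sup>2 * (1 + u (x + h))\<^sup>2"
            using True by (intro mult_left_mono one_le_power) auto
          also have "\<dots> = e (x + h)" by (simp add: e_def) algebra
          finally show ?thesis using True by simp
        qed (use e0 in auto)
        moreover have "?w \<le> \<delta> + ?w\<^sup>2 / \<delta>"
        proof -
          \<comment> \<open>A form of Young's inequality; it trades the excess \<open>?w\<close>,
            whose integrability is unknown, for a constant plus the integrable energy
            density.\<close>
          have "0 \<le> (?w - \<delta>)\<^sup>2 + \<delta> * ?w" using \<delta> by simp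
          then have "?w * \<delta> \<le> \<delta>\<^sup>2 + ?w\<^sup>2" by (simp add: power2_eq_square algebra_simps)
          then have "?w \<le> (\<delta>\<^sup>2 + ?w\<^sup>2) / \<delta>" using \<delta> by (simp add: pos_le_divide_eq del: max.bounded_iff)
          then show ?thesis using \<delta> by (simp add: add_divide_distrib power2_eq_square del: max.bounded_iff)
        qed
        ultimately have w: "?w \<le> \<delta> + e (x + h) / \<delta>"
          using \<delta> by (smt (verit) divide_right_mono)
        have "- G h = (u (x + h) - u x) / norm h powr ?p"
          using False by (simp add: G_def minus_divide_left)
        \<comment> \<open>Because \<open>u x \<ge> 1\<close>, the increment
          \<open>u (x + h) - u x\<close> is at most \<open>?w\<close>.\<close>
        also have "\<dots> \<le> (\<delta> + e (x + h) / \<delta>) / norm h powr ?p"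
          using w x by (intro divide_right_mono) auto
        also have "\<dots> = \<delta> / norm h powr ?p + norm h powr - ?p * (e (x + h) / \<delta>)"
          unfolding powr_minus[of _ ?p] by (simp add: divide_inverse algebra_simps)
        also have "\<dots> \<le> \<delta> / norm h powr ?p + r powr - ?p * (e (x + h) / \<delta>)"
          using False r \<delta> e0 \<alpha> by (intro add_left_mono mult_right_mono powr_mono2') auto
        also have "\<dots> = ?R h" using False by simp
        finally show ?thesis .
      qed
      then show ?thesis using R0 by (auto simp: indicator_def)
    qed
    obtain l where l: "((\<lambda>\<epsilon>. LINT y:{y. norm (x - y) > \<epsilon>}|lebesgue. (u x - u y) / norm (x - y) powr ?p)
       \<longlongrightarrow> l) (at_right 0)"
      and eq: "frac_laplacian \<alpha> u x = frac_const DIM('a) \<alpha> * l"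
      using frac_laplacian_limit[OF \<alpha> u] by blast
    have "- ((A + B + I) * ?S) \<le> l"
    proof (rule tendsto_lowerbound[OF l])
      show "\<forall>\<^sub>F \<epsilon> in at_right 0. - ((A + B + I) * ?S)
          \<le> (LINT y:{y. norm (x - y) > \<epsilon>}|lebesgue. (u x - u y) / norm (x - y) powr ?p)"
      proof (rule eventually_at_rightI[of 0 1])
        fix \<epsilon> :: real assume "\<epsilon> \<in> {0<..<1}"
        then have \<epsilon>: "0 < \<epsilon>" by simp
        have c: "integrable lborel (\<lambda>h. indicat_real {h. \<epsilon> < norm h} h * G h)"
          "(LINT h|lborel. indicat_real {h. \<epsilon> < norm h} h * ((u x - u (x + h)) / norm h powr ?p))
            = (LINT h|lborel. indicat_real {h. \<epsilon> < norm h} h * G h)"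
          unfolding G_def by (rule truncated_integral_linear_correction[OF cont uL \<alpha>(1) \<epsilon>])+
        have "- (LINT h|lborel. indicat_real {h. \<epsilon> < norm h} h * G h) \<le> integral\<^sup>L lborel ?R"
          unfolding Bochner_Integration.integral_minus[symmetric]
          by (intro integral_mono Ri pw Bochner_Integration.integrable_minus c(1))
        then show "- ((A + B + I) * ?S)
          \<le> (LINT y:{y. norm (x - y) > \<epsilon>}|lebesgue. (u x - u y) / norm (x - y) powr ?p)"
          using R c(2) by (simp add: truncated_integral_translate)
      qed simp
    qed simp
    from mult_left_mono[OF this frac_const_nonneg[OF \<alpha>(1), of "DIM('a)"]]
    show ?thesis unfolding eq C_def by (simp add: mult.assoc)
  qed
  moreover have "0 \<le> C" unfolding C_def using frac_const_nonneg[OF \<alpha>(1), of "DIM('a)"] AB I0 by simp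
  ultimately show thesis using that by blast
qed

section \<open>Selection of a touching paraboloid\<close>

text \<open>Two maximisations are combined. The weighted one yields \<open>x1\<close> with large
  \<open>M * r ^ k\<close> and \<open>w\<close> bounded by \<open>2 ^ k * M\<close> nearby;
  subtracting a paraboloid centred at \<open>x1\<close> and maximising again yields an interior
  maximum \<open>x2\<close>, where the touching inequality holds.\<close>

lemma touching_paraboloid:
  fixes w :: "'a::euclidean_space \<Rightarrow> real"
  assumes cont: "continuous_on UNIV w" and z: "0 < w z" and \<rho>: "0 < \<rho>" and k: "0 < k"
  obtains x v r M where "0 < r" "r \<le> \<rho>" "0 < M" "w z * \<rho> ^ k \<le> M * r ^ k" "M \<le> w x"
    "\<And>h. norm h \<le> r \<Longrightarrow> w (x + h) - w x \<le> (2 ^ k * M / r\<^sup>2) * (norm h)\<^sup>2 + v \<bullet> h"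
proof -
  define R where "R = 4 * \<rho>"
  have R: "0 < R" using \<rho> by (simp add: R_def)
  let ?f = "\<lambda>y. (R - dist z y) ^ k * w y"
  have "continuous_on (cball z R) ?f"
    by (intro continuous_intros continuous_on_subset[OF cont]) auto
  then obtain x1 where x1: "x1 \<in> cball z R" and max1: "\<And>y. y \<in> cball z R \<Longrightarrow> ?f y \<le> ?f x1"
    using continuous_attains_sup[of "cball z R" ?f] R by force
  \<comment> \<open>\<open>d\<close> is the distance from \<open>x1\<close> to the boundary of the
    large ball. With \<open>r = d / 4\<close>, points within \<open>2 * r\<close> of
    \<open>x1\<close> keep distance at least \<open>d / 2\<close> from the boundary, so the weight
    drops by at most \<open>2 ^ k\<close>.\<close>
  define d r M where "d = R - dist z x1" and "r = d / 4" and "M = w x1"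
  have f1: "R ^ k * w z \<le> d ^ k * M" using max1[of z] R by (simp add: d_def M_def)
  have "0 < R ^ k * w z" using R z by simp
  with f1 have pos: "0 < d ^ k * M" by linarith
  have "0 \<le> d" using x1 by (simp add: d_def)
  \<comment> \<open>A boundary maximum would have weight 0, as \<open>k\<close> is positive, against
    the positive value at \<open>z\<close>.\<close>
  with pos k have d: "0 < d" by (cases "d = 0") (auto simp: zero_power)
  with pos have M: "0 < M" by (simp add: zero_less_mult_iff)
  have r: "0 < r" "r \<le> \<rho>" using d by (auto simp: r_def d_def R_def)
  have "w z * \<rho> ^ k * 4 ^ k \<le> M * r ^ k * 4 ^ k"
    using f1 by (simp add: R_def r_def power_mult_distrib power_divide mult_ac)
  then have growth: "w z * \<rho> ^ k \<le> M * r ^ k" by simp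
  have w_le: "w y \<le> 2 ^ k * M" if y: "y \<in> cball x1 (2 * r)" for y
  proof (cases "0 \<le> w y")
    case True
    have y': "d / 2 \<le> R - dist z y"
      using y dist_triangle[of z y x1] by (simp add: d_def r_def)
    have "(d / 2) ^ k * w y \<le> (R - dist z y) ^ k * w y"
      using True d y' by (intro mult_right_mono power_mono) auto
    also have "\<dots> \<le> d ^ k * M" using max1[of y] y' d by (simp add: d_def M_def)
    finally have "d ^ k * w y \<le> d ^ k * (2 ^ k * M)" by (simp add: power_divide field_simps)
    then show ?thesis using d by simp
  next
    case False
    moreover have "0 \<le> 2 ^ k * M" using M by simp
    ultimately show ?thesis by linarith
  qed
  \<comment> \<open>The opening is such that at distance \<open>r\<close> the paraboloid has reached
    the upper bound \<open>2 ^ k * M\<close> of \<open>w\<close>. Hence \<open>x2\<close> is within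
    \<open>r\<close> of \<open>x1\<close>, and the ball of radius \<open>r\<close> around
    \<open>x2\<close> stays in the region of maximisation.\<close>
  define \<mu> where "\<mu> = 2 ^ k * M / r\<^sup>2"
  have \<mu>: "0 < \<mu>" using M r by (simp add: \<mu>_def)
  let ?g = "\<lambda>y. w y - \<mu> * (norm (y - x1))\<^sup>2"
  have "continuous_on (cball x1 (2 * r)) ?g"
    by (intro continuous_intros continuous_on_subset[OF cont]) auto
  then obtain x2 where x2: "x2 \<in> cball x1 (2 * r)" and max2: "\<And>y. y \<in> cball x1 (2 * r) \<Longrightarrow> ?g y \<le> ?g x2"
    using continuous_attains_sup[of "cball x1 (2 * r)" ?g] r by force
  have g2: "M \<le> ?g x2" using max2[of x1] r by (simp add: M_def)
  have nn: "0 \<le> \<mu> * (norm (x2 - x1))\<^sup>2" using \<mu> by simp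
  have Mx: "M \<le> w x2" using g2 nn by linarith
  have "\<mu> * (norm (x2 - x1))\<^sup>2 \<le> \<mu> * r\<^sup>2"
    using g2 w_le[OF x2] M r by (simp add: \<mu>_def)
  then have near: "norm (x2 - x1) \<le> r" using \<mu> r by (simp add: power2_le_iff_abs_le)
  have "w (x2 + h) - w x2 \<le> \<mu> * (norm h)\<^sup>2 + ((2 * \<mu>) *\<^sub>R (x2 - x1)) \<bullet> h" if h: "norm h \<le> r" for h
  proof -
    have "dist x1 (x2 + h) \<le> norm (x2 - x1) + norm h"
      using norm_triangle_ineq[of "x2 - x1" h] by (simp add: dist_norm norm_minus_commute algebra_simps)
    then have "?g (x2 + h) \<le> ?g x2" using near h by (intro max2) simp
    then have "w (x2 + h) - w x2 \<le> \<mu> * ((norm (x2 + h - x1))\<^sup>2 - (norm (x2 - x1))\<^sup>2)"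
      by (simp add: right_diff_distrib)
    also have "(norm (x2 + h - x1))\<^sup>2 - (norm (x2 - x1))\<^sup>2 = (norm h)\<^sup>2 + 2 * ((x2 - x1) \<bullet> h)"
      by (simp add: power2_norm_eq_inner inner_commute algebra_simps)
    finally show ?thesis by (simp add: distrib_left)
  qed
  then show thesis using that[OF r M growth Mx, of "(2 * \<mu>) *\<^sub>R (x2 - x1)"] by (simp add: \<mu>_def)
qed

section \<open>Scaling contradiction\<close>

text \<open>The scale-adapted quantity is \<open>P = M * r ^ k\<close>, which is at least
  \<open>a * \<rho> ^ k\<close>. Multiplying the negated inequality by \<open>r ^ (2 * k)\<close> or
  \<open>r ^ (4 * k)\<close> bounds \<open>P\<close> from above too weakly to allow this once
  \<open>\<rho>\<close> is large.\<close>

lemma blowup_contradiction: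
  fixes a D p \<alpha> :: real
  assumes a: "0 < a" and D: "0 \<le> D" and \<alpha>: "0 < \<alpha>" "\<alpha> \<le> p" and p: "1 \<le> p" "p \<le> 2 * real k"
  obtains \<rho> where "0 < \<rho>"
    "\<And>M r. \<lbrakk>0 < r; r \<le> \<rho>; 0 < M; a * \<rho> ^ k \<le> M * r ^ k\<rbrakk>
      \<Longrightarrow> D * (M\<^sup>2 * r powr - \<alpha> + r powr - p) < 2 * M\<^sup>2 + M ^ 4"
proof -
  \<comment> \<open>\<open>r0\<close> bounds every scale with
    \<open>D * r powr - \<alpha> > 1\<close>; \<open>E\<close> collects the powers of
    \<open>r\<close> that remain at these scales, evaluated at \<open>r0\<close>.\<close>
  define r0 where "r0 = (D + 1) powr (1 / \<alpha>)"
  define E where "E = D * (r0 powr (2 * k - \<alpha>) + r0 powr (4 * k - p))"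
  have E0: "0 \<le> E" using D by (simp add: E_def)
  have k: "1 \<le> k" using p by (cases k) auto
  \<comment> \<open>Each summand serves one estimate: \<open>1 / a\<close> gives
    \<open>P \<ge> 1\<close>, \<open>D / a^2\<close> rules out large \<open>r\<close> and
    \<open>E / a^2\<close> small \<open>r\<close>. The leading 1 makes the last two strict.\<close>
  define \<rho> where "\<rho> = 1 + 1 / a + D / a\<^sup>2 + E / a\<^sup>2"
  have nn: "0 \<le> 1 / a" "0 \<le> D / a\<^sup>2" "0 \<le> E / a\<^sup>2" using a D E0 by auto
  have \<rho>1: "1 \<le> \<rho>" and \<rho>a: "1 / a \<le> \<rho>" and "D / a\<^sup>2 < \<rho>" "E / a\<^sup>2 < \<rho>"
    unfolding \<rho>_def using nn by linarith+
  then have \<rho>D: "D < a\<^sup>2 * \<rho>" and \<rho>E: "E < a\<^sup>2 * \<rho>" using a by (auto simp: divide_simps mult.commute)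
  have "D * (M\<^sup>2 * r powr - \<alpha> + r powr - p) < 2 * M\<^sup>2 + M ^ 4"
    if r: "0 < r" "r \<le> \<rho>" and M: "0 < M" and growth: "a * \<rho> ^ k \<le> M * r ^ k" for M r
  proof (rule ccontr)
    assume "\<not> ?thesis"
    then have le: "2 * M\<^sup>2 + M ^ 4 \<le> D * (M\<^sup>2 * r powr - \<alpha> + r powr - p)" by simp
    define P where "P = M * r ^ k"
    have "(a * \<rho> ^ k)\<^sup>2 \<le> P\<^sup>2" unfolding P_def using growth a \<rho>1 by (intro power_mono) auto
    then have P2: "a\<^sup>2 * \<rho> ^ (2 * k) \<le> P\<^sup>2" by (simp add: power_mult_distrib power_mult[symmetric] mult.commute)
    have rk: "r ^ m = r powr real m" for m using r by (simp add: powr_realpow)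
    show False
    proof (cases "D * r powr - \<alpha> \<le> 1")
      \<comment> \<open>Large scales: one of the two copies of \<open>M^2\<close> absorbs the first
        term on the right, leaving \<open>M^2 \<le> D * r powr - p\<close>.\<close>
      case True
      have "D * (M\<^sup>2 * r powr - \<alpha>) \<le> M\<^sup>2"
        using mult_right_mono[OF True, of "M\<^sup>2"] by (simp add: mult_ac)
      moreover have "0 \<le> M ^ 4" by simp
      ultimately have "M\<^sup>2 \<le> D * r powr - p" using le unfolding distrib_left by linarith
      then have "M\<^sup>2 * r ^ (2 * k) \<le> D * r powr - p * r ^ (2 * k)" using r by (intro mult_right_mono) auto
      then have "P\<^sup>2 \<le> D * r powr - p * r ^ (2 * k)"
        by (simp add: P_def power_mult_distrib power_mult[symmetric] mult.commute)
      also have "\<dots> = D * r powr (2 * k - p)" by (simp add: rk powr_add[symmetric])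
      also have "\<dots> \<le> D * \<rho> powr (2 * k - p)" using D r p by (intro mult_left_mono powr_mono2) auto
      finally have "a\<^sup>2 * \<rho> ^ (2 * k) \<le> D * \<rho> powr (2 * k - p)" using P2 by linarith
      moreover have "\<rho> ^ (2 * k) = \<rho> powr p * \<rho> powr (2 * k - p)"
        using \<rho>1 by (simp add: powr_realpow[symmetric] powr_add[symmetric])
      ultimately have "(a\<^sup>2 * \<rho> powr p) * \<rho> powr (2 * k - p) \<le> D * \<rho> powr (2 * k - p)" by (simp add: mult.assoc)
      then have "a\<^sup>2 * \<rho> powr p \<le> D" using \<rho>1 by (subst (asm) mult_le_cancel_right) auto
      moreover have "a\<^sup>2 * \<rho> powr 1 \<le> a\<^sup>2 * \<rho> powr p" using \<rho>1 p by (intro mult_left_mono powr_mono) auto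
      ultimately show False using \<rho>D \<rho>1 by simp
    next
      \<comment> \<open>Small scales: the quartic term alone is kept on the left, and
        \<open>P \<ge> 1\<close> lets both terms on the right be bounded by multiples of
        \<open>P^2\<close>.\<close>
      case False
      then have "r powr \<alpha> < D" using r by (simp add: powr_minus field_simps)
      then have "(r powr \<alpha>) powr (1 / \<alpha>) \<le> r0" unfolding r0_def using \<alpha> by (intro powr_mono2) auto
      then have r0: "r \<le> r0" using r \<alpha> by (simp add: powr_powr)
      have "1 \<le> a * \<rho>" using \<rho>a a by (simp add: divide_simps mult.commute)
      also have "\<dots> \<le> a * \<rho> ^ k" using \<rho>1 k a self_le_power[of \<rho> k] by simp
      also have "\<dots> \<le> P" using growth by (simp add: P_def)
      finally have P1: "1 \<le> P" .
      have "M ^ 4 \<le> D * (M\<^sup>2 * r powr - \<alpha> + r powr - p)" using le by (smt (verit) zero_le_power2)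
      then have "M ^ 4 * r ^ (4 * k) \<le> D * (M\<^sup>2 * r powr - \<alpha> + r powr - p) * r ^ (4 * k)"
        using r by (intro mult_right_mono) auto
      also have "\<dots> = D * ((M\<^sup>2 * r ^ (2 * k)) * (r powr - \<alpha> * r ^ (2 * k)) + r powr - p * r ^ (4 * k))"
        by (simp add: algebra_simps power_add[symmetric])
      also have "\<dots> = D * (P\<^sup>2 * (r powr - \<alpha> * r ^ (2 * k)) + 1 * (r powr - p * r ^ (4 * k)))"
        by (simp add: P_def power_mult_distrib power_mult[symmetric] mult.commute[of k 2])
      also have "\<dots> = D * (P\<^sup>2 * r powr (2 * k - \<alpha>) + 1 * r powr (4 * k - p))"
        by (simp add: rk powr_add[symmetric])
      also have "\<dots> \<le> D * (P\<^sup>2 * r0 powr (2 * k - \<alpha>) + P\<^sup>2 * r0 powr (4 * k - p))"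
        using D r0 r P1 p \<alpha> by (intro mult_left_mono add_mono mult_mono powr_mono2 one_le_power) auto
      also have "\<dots> = E * P\<^sup>2" by (simp add: E_def algebra_simps)
      finally have "P\<^sup>2 * P\<^sup>2 \<le> E * P\<^sup>2"
        by (simp add: P_def power_mult_distrib power_mult[symmetric] power_add[symmetric] mult_ac)
      then have "P\<^sup>2 \<le> E" using P1 by (subst (asm) mult_le_cancel_right) auto
      moreover have "a\<^sup>2 * \<rho> \<le> a\<^sup>2 * \<rho> ^ (2 * k)" using \<rho>1 k self_le_power[of \<rho> "2 * k"] by (intro mult_left_mono) auto
      ultimately show False using P2 \<rho>E by linarith
    qed
  qed
  with \<rho>1 show thesis by (intro that[of \<rho>]) auto
qed

section \<open>The bound for solutions\<close>

lemma Ginzburg_Landau_upper_bound: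
  fixes u :: "'a::euclidean_space \<Rightarrow> real" and \<alpha> :: real
  assumes \<alpha>: "0 < \<alpha>" "\<alpha> < 2" and u: "u \<in> C11_loc \<inter> L_weighted \<alpha>"
    and eq: "\<And>x. frac_laplacian \<alpha> u x = u x * (1 - \<bar>u x\<bar>\<^sup>2)"
    and int: "integrable lebesgue (\<lambda>x. (1 - \<bar>u x\<bar>\<^sup>2)\<^sup>2)"
  shows "u z \<le> 1"
proof (rule ccontr)
  assume "\<not> u z \<le> 1"
  then have z: "0 < u z - 1" by simp
  let ?p = "real DIM('a) + \<alpha>"
  \<comment> \<open>This exponent satisfies \<open>DIM('a) + \<alpha> \<le> 2 * k\<close>, as
    \<open>blowup_contradiction\<close> requires.\<close>
  define k where "k = DIM('a) + 2"
  obtain C where C: "0 \<le> C"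
    and bound: "\<And>x \<mu> v r \<delta>. \<lbrakk>0 \<le> \<mu>; 0 < r; 0 < \<delta>; 1 \<le> u x;
       \<And>h. norm h \<le> r \<Longrightarrow> u (x + h) - u x \<le> \<mu> * (norm h)\<^sup>2 + v \<bullet> h\<rbrakk>
     \<Longrightarrow> - frac_laplacian \<alpha> u x
       \<le> C * (\<mu> * r powr (2 - \<alpha>) + \<delta> * r powr - \<alpha> + r powr - ?p / \<delta>)"
    using frac_laplacian_lower_bound[OF \<alpha> u int] by blast
  define D where "D = C * (2 ^ k + 1)"
  have D: "0 \<le> D" using C by (simp add: D_def)
  have p: "1 \<le> ?p" "\<alpha> \<le> ?p" "?p \<le> 2 * real k"
  proof -
    have "1 \<le> real DIM('a)" using DIM_ge_Suc0[where ?'a = 'a] by simp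
    then show "1 \<le> ?p" "\<alpha> \<le> ?p" using \<alpha> by linarith+
    show "?p \<le> 2 * real k" using \<alpha> by (simp add: k_def)
  qed
  obtain \<rho> where \<rho>: "0 < \<rho>" and contra: "\<And>M r. \<lbrakk>0 < r; r \<le> \<rho>; 0 < M; (u z - 1) * \<rho> ^ k \<le> M * r ^ k\<rbrakk>
      \<Longrightarrow> D * (M\<^sup>2 * r powr - \<alpha> + r powr - ?p) < 2 * M\<^sup>2 + M ^ 4"
    using blowup_contradiction[OF z D \<alpha>(1) p(2) p(1) p(3)] by blast
  have cont: "continuous_on UNIV (\<lambda>y. u y - 1)"
    using u C11_loc_continuous by (intro continuous_intros) auto
  have k0: "0 < k" by (simp add: k_def)
  obtain x v r M where r: "0 < r" "r \<le> \<rho>" and M: "0 < M" "(u z - 1) * \<rho> ^ k \<le> M * r ^ k" "M \<le> u x - 1"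
    and touch: "\<And>h. norm h \<le> r \<Longrightarrow> (u (x + h) - 1) - (u x - 1) \<le> (2 ^ k * M / r\<^sup>2) * (norm h)\<^sup>2 + v \<bullet> h"
    by (rule touching_paraboloid[OF cont z \<rho> k0], rule that)
  let ?\<mu> = "2 ^ k * M / r\<^sup>2"
  have "r powr (2 - \<alpha>) = r powr 2 * r powr - \<alpha>" by (simp add: powr_add[symmetric])
  then have scale: "?\<mu> * r powr (2 - \<alpha>) = 2 ^ k * M * r powr - \<alpha>" using r by simp
  \<comment> \<open>The right side of the equation, negated, is
    \<open>(u - 1) * u * (u + 1)\<close>, which increases for \<open>u \<ge> 1\<close> and is
    evaluated at \<open>u = 1 + M\<close>.\<close>
  have "2 * M + M ^ 3 \<le> M * (M + 1) * (M + 2)"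
    using M(1) by (simp add: algebra_simps power3_eq_cube)
  also have "\<dots> \<le> (u x - 1) * u x * (u x + 1)"
    using M by (intro mult_mono) auto
  also have "\<dots> = - frac_laplacian \<alpha> u x" unfolding eq by (simp add: algebra_simps power2_eq_square)
  \<comment> \<open>Taking \<open>\<delta> = M\<close> gives the constant far-field term the same
    form \<open>M * r powr - \<alpha>\<close> as the paraboloid term.\<close>
  also have "\<dots> \<le> C * (?\<mu> * r powr (2 - \<alpha>) + M * r powr - \<alpha> + r powr - ?p / M)"
    using M r touch by (intro bound) auto
  also have "\<dots> \<le> D * (M * r powr - \<alpha> + r powr - ?p / M)"
  proof -
    have "?\<mu> * r powr (2 - \<alpha>) + M * r powr - \<alpha> + r powr - ?p / M
        = (2 ^ k + 1) * (M * r powr - \<alpha>) + 1 * (r powr - ?p / M)"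
      unfolding scale by (simp add: algebra_simps)
    also have "\<dots> \<le> (2 ^ k + 1) * (M * r powr - \<alpha>) + (2 ^ k + 1) * (r powr - ?p / M)"
      using M by (intro add_left_mono mult_right_mono) auto
    also have "\<dots> = (2 ^ k + 1) * (M * r powr - \<alpha> + r powr - ?p / M)" by (rule distrib_left[symmetric])
    finally show ?thesis unfolding D_def mult.assoc using C by (rule mult_left_mono)
  qed
  finally have "(2 * M + M ^ 3) * M \<le> D * (M * r powr - \<alpha> + r powr - ?p / M) * M"
    using M by (intro mult_right_mono) auto
  also have "\<dots> = D * (M\<^sup>2 * r powr - \<alpha> + r powr - ?p)"
    using M by (simp add: field_simps power2_eq_square)
  finally have "2 * M\<^sup>2 + M ^ 4 \<le> D * (M\<^sup>2 * r powr - \<alpha> + r powr - ?p)"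
    by (simp add: algebra_simps power2_eq_square power_Suc numeral_eq_Suc)
  with contra[OF r M(1,2)] show False by linarith
qed

theorem theorem1:
  fixes \<alpha> :: real and u :: "real ^ 'n \<Rightarrow> real"
  assumes "0 < \<alpha>" and "\<alpha> < 2"
    and "u \<in> C11_loc \<inter> L_weighted \<alpha>"
    and "\<And>x. frac_laplacian \<alpha> u x = u x * (1 - \<bar>u x\<bar>\<^sup>2)"
    and "integrable lebesgue (\<lambda>x. (1 - \<bar>u x\<bar>\<^sup>2)\<^sup>2)"
  shows "\<forall>x. \<bar>u x\<bar> \<le> 1"
proof
  fix x
  have "u x \<le> 1" using Ginzburg_Landau_upper_bound assms by blast
  \<comment> \<open>The energy is even and the nonlinearity odd in \<open>u\<close>, so
    \<open>- u\<close> meets the same hypotheses.\<close>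
  moreover have "- u x \<le> 1"
    using Ginzburg_Landau_upper_bound[OF assms(1,2) uminus_C11_L_weighted[OF assms(3)], of x]
      assms(4,5) frac_laplacian_uminus[OF assms(1-3)] by simp
  ultimately show "\<bar>u x\<bar> \<le> 1" by simp
qed

end
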